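(* Let $V$ be defined on $S$ by $$(Vx)_k=x_k\Big(x_k^2+3\sum_{i=1}^{k-1}x_i-3\sum_{\substack{i,j=1\\ i<j}}^{k-1}x_ix_j\Big),\qquad k\in\mathbb{N},\ x\in S$$ (empty sums being $0$, so $(Vx)_1=x_1^3$ and $(Vx)_2=x_2(x_2^2+3x_1)$). Then $V$ is a cubic Volterra operator $S\to S$ which is a bijection of $S$, but, writing $(Vx)_k=x_k(1+f_k(x))$ with $$f_k(x)=x_k^2+3\sum_{i=1}^{k-1}x_i-3\sum_{\substack{i,j=1\\ i<j}}^{k-1}x_ix_j-1,$$ the condition $$\sum_{k=1}^\infty x_kf_k(y)+\sum_{k=1}^\infty y_kf_k(x)\le 0\quad\text{for every } x,y\in S$$ is not satisfied.
   Context: $\mathbb{N}=\{1,2,\dots\}$; $\ell_1$ is the space of absolutely summable real sequences; $S=\{x=(x_n)\in\ell_1: x_i\ge 0,\ \sum_{n=1}^\infty x_n=1\}$. For $\alpha\subset\mathbb{N}$ the face $S_\alpha$ is $\{x\in S: x_k=0\ \forall k\in\mathbb{N}\setminus\alpha\}$. A mapping $V:S\to S$ is a cubic stochastic operator if $(Vx)_k=\sum_{i,j,l=1}^\infty p_{ijl,k}x_ix_jx_l$ for all $k\in\mathbb{N}$, $x\in S$, where $p_{ijl,k}\ge 0$, $\sum_{k=1}^\infty p_{ijl,k}=1$, and $p_{ijl,k}=p_{\pi(i)\pi(j)\pi(l),k}$ for every permutation $\pi$ of the index set $\{i,j,l\}$. A cubic stochastic operator is called a cubic Volterra operator if every face $S_\alpha$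 of the simplex is invariant with respect to $V$. *)

theory Defs
  imports "HOL-Analysis.Analysis"
begin

text \<open>
  Sequences indexed by \<open>{1, 2, \<dots>}\<close> are functions on \<^typ>\<open>nat\<close>: the coordinate
  \<open>x 0\<close> is the first one, \<open>x 1\<close> the second one, and so on.
\<close>

definition ell1 :: "(nat \<Rightarrow> real) set" where
  "ell1 = {x. summable (\<lambda>n. \<bar>x n\<bar>)}"

definition inf_simplex :: "(nat \<Rightarrow> real) set" where
  "inf_simplex = {x \<in> ell1. (\<forall>i. 0 \<le> x i) \<and> (\<Sum>n. x n) = 1}"

definition simplex_face :: "nat set \<Rightarrow> (nat \<Rightarrow> real) set" where
  "simplex_face \<alpha> = {x \<in> inf_simplex. \<forall>k. k \<notin> \<alpha> \<longrightarrow> x k = 0}"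

text \<open>
  Symmetry means invariance under all rearrangements of the triple \<open>(i, j, l)\<close>, whose
  entries may coincide. The triple series is unordered; all its terms are nonnegative.
\<close>

definition cubic_stochastic_operator :: "((nat \<Rightarrow> real) \<Rightarrow> nat \<Rightarrow> real) \<Rightarrow> bool" where
  "cubic_stochastic_operator V \<longleftrightarrow>
     V \<in> inf_simplex \<rightarrow> inf_simplex \<and>
     (\<exists>p :: nat \<Rightarrow> nat \<Rightarrow> nat \<Rightarrow> nat \<Rightarrow> real.
        (\<forall>i j l k. 0 \<le> p i j l k) \<and>
        (\<forall>i j l. (\<lambda>k. p i j l k) sums 1) \<and>
        (\<forall>i j l k. p i j l k = p i l j k \<and> p i j l k = p j i l k \<and> p i j l k = p j l i k \<and>
                   p i j l k = p l i j k \<and> p i j l k = p l j i k) \<and>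
        (\<forall>x\<in>inf_simplex. \<forall>k.
           ((\<lambda>(i, j, l). p i j l k * x i * x j * x l) has_sum V x k) UNIV))"

definition cubic_Volterra_operator :: "((nat \<Rightarrow> real) \<Rightarrow> nat \<Rightarrow> real) \<Rightarrow> bool" where
  "cubic_Volterra_operator V \<longleftrightarrow>
     cubic_stochastic_operator V \<and> (\<forall>\<alpha>. V ` simplex_face \<alpha> \<subseteq> simplex_face \<alpha>)"

end

theory Submission
  imports Defs
begin

text \<open>
  Write \<open>s\<^sub>n\<close> for the sum of the first \<open>n\<close> coordinates of \<open>x\<close> and \<open>e\<^sub>n\<close> for the sum of the
  products of pairs of them. Everything about the size of \<open>V x\<close> follows from one identity,
  which holds for every real sequence (\<open>sum_cubic_map\<close>):
  \<open>(V x)\<^sub>0 + \<dots> + (V x)\<^sub>n\<^sub>-\<^sub>1 = s\<^sub>n\<^sup>3 + 3 e\<^sub>n (1 - s\<^sub>n)\<close>.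
  On the simplex \<open>s\<^sub>n\<close> tends to 1 and \<open>e\<^sub>n\<close> stays bounded, so \<open>V x\<close> has total mass 1.

  The map is triangular: \<open>(V x)\<^sub>k\<close> depends on the coordinates up to \<open>k\<close> only, and with the earlier
  ones held fixed it is a strictly increasing function of \<open>x\<^sub>k\<close>, because \<open>e\<^sub>k \<le> s\<^sub>k\<close>. Hence \<open>V\<close> is
  injective. For surjectivity the equation \<open>V x = y\<close> is solved one coordinate at a time by the
  intermediate value theorem on \<open>[0, 1 - s\<^sub>k]\<close>: taking the right end point would exhaust the mass
  of \<open>x\<close>, hence by the identity also that of its image, so the value there is at least \<open>y\<^sub>k\<close>
  (\<open>next_coordinate_exists\<close>). What remains is that the limit \<open>s\<close> of the partial sums is 1. The identity
  and \<open>2 e\<^sub>n \<le> s\<^sub>n\<^sup>2\<close> give \<open>2 \<le> 3 s\<^sup>2 - s\<^sup>3\<close>, and \<open>2 - 3 s\<^sup>2 + s\<^sup>3\<close> is positive for \<open>0 \<le> s < 1\<close>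
  (\<open>no_lost_mass\<close>).

  The heredity coefficients of \<open>V\<close> are obtained by writing \<open>(V x)\<^sub>k\<close> as a triple series with a
  nonsymmetric kernel, homogenizing the quadratic term with a factor \<open>\<Sum> x\<^sub>l = 1\<close>, and averaging over the
  six rearrangements. The outcome is nonnegative: three distinct parents pass on their middle or their
  largest type with probability 1/2 each, all other triples pass on their largest type
  (\<open>heredity_sorted\<close>). Finally, the two first vertices violate the inequality, the left-hand
  side being \<open>-1 + 2\<close>.
\<close>

section \<open>The partial sum identity\<close>

definition pair_sum :: "(nat \<Rightarrow> real) \<Rightarrow> nat \<Rightarrow> real" where
  "pair_sum x k = (\<Sum>(i, j)\<in>{(i, j). i < j \<and> j < k}. x i * x j)"

definition cubic_map :: "(nat \<Rightarrow> real) \<Rightarrow> nat \<Rightarrow> real" where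
  "cubic_map x k = x k * ((x k)\<^sup>2 + 3 * (\<Sum>i<k. x i) - 3 * pair_sum x k)"

lemma finite_pairs_below: "finite {(i, j). i < j \<and> j < (k::nat)}"
  by (rule finite_subset[of _ "{..<k} \<times> {..<k}"]) auto

lemma pair_sum_0 [simp]: "pair_sum x 0 = 0"
  by (simp add: pair_sum_def)

lemma pair_sum_Suc: "pair_sum x (Suc k) = pair_sum x k + x k * (\<Sum>i<k. x i)"
proof -
  have eq: "{(i, j). i < j \<and> j < Suc k} = {(i, j). i < j \<and> j < k} \<union> (\<lambda>i. (i, k)) ` {..<k}"
    by (auto simp: less_Suc_eq)
  have "pair_sum x (Suc k) = pair_sum x k + (\<Sum>(i, j)\<in>(\<lambda>i. (i, k)) ` {..<k}. x i * x j)"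
    unfolding pair_sum_def eq by (rule sum.union_disjoint) (auto simp: finite_pairs_below)
  also have "(\<Sum>(i, j)\<in>(\<lambda>i. (i, k)) ` {..<k}. x i * x j) = (\<Sum>i<k. x i * x k)"
    by (subst sum.reindex) (auto simp: inj_on_def)
  finally show ?thesis
    by (simp add: sum_distrib_left mult.commute)
qed

lemma pair_sum_nonneg:
  assumes "\<And>i. 0 \<le> x i" shows "0 \<le> pair_sum x k"
  unfolding pair_sum_def using assms by (auto intro!: sum_nonneg)

text \<open>
  The square of the sum is the sum of the squares plus twice the pair sum.
\<close>

lemma pair_sum_le: "2 * pair_sum x k \<le> (\<Sum>i<k. x i)\<^sup>2"
proof (induction k)
  case (Suc k)
  from add_increasing[OF zero_le_power2[of "x k"] Suc] show ?case
    by (simp add: pair_sum_Suc power2_sum algebra_simps)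
qed simp

text \<open>
  The inductive step is the identity, for \<open>s\<close>, \<open>e\<close> and a new coordinate \<open>a\<close>,
  \<open>(s + a)\<^sup>3 + 3 (e + a s) (1 - s - a) = s\<^sup>3 + 3 e (1 - s) + a (a\<^sup>2 + 3 s - 3 e)\<close>.
  For finitely supported \<open>x\<close> of total mass 1 it says that the mass is preserved exactly; in general
  the last summand is the correction for the mass \<open>1 - s\<close> still to come.
\<close>

lemma sum_cubic_map:
  fixes x :: "nat \<Rightarrow> real"
  shows "(\<Sum>k<n. cubic_map x k) = (\<Sum>i<n. x i) ^ 3 + 3 * pair_sum x n * (1 - (\<Sum>i<n. x i))"
proof (induction n)
  case (Suc n)
  then show ?case
    by (simp add: pair_sum_Suc cubic_map_def algebra_simps power2_eq_square power3_eq_cube)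
qed simp

section \<open>The simplex is mapped into itself\<close>

lemma inf_simplex_iff_sums:
  "x \<in> inf_simplex \<longleftrightarrow> (\<forall>i. 0 \<le> x i) \<and> x sums 1"
proof
  assume "(\<forall>i. 0 \<le> x i) \<and> x sums 1"
  moreover from this have "(\<lambda>n. \<bar>x n\<bar>) = x" by auto
  ultimately show "x \<in> inf_simplex"
    by (auto simp: inf_simplex_def ell1_def sums_iff)
qed (auto simp: inf_simplex_def ell1_def sums_iff)

lemma sum_le_1:
  assumes "x \<in> inf_simplex" shows "(\<Sum>i<n. x i) \<le> 1"
  using assms sum_le_suminf[of x "{..<n}"] by (auto simp: inf_simplex_iff_sums sums_iff)

lemma sum_nonneg_simplex:
  assumes "x \<in> inf_simplex" shows "0 \<le> (\<Sum>i<n. x i)"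
  using assms by (auto simp: inf_simplex_iff_sums intro: sum_nonneg)

lemma pair_le_total:
  fixes s e :: real
  assumes "0 \<le> s" "s \<le> 1" "2 * e \<le> s\<^sup>2" shows "e \<le> s"
proof -
  have "s\<^sup>2 \<le> s" using assms by (simp add: power2_eq_square mult_left_le)
  with assms show ?thesis by linarith
qed

lemma pair_sum_le_sum:
  assumes "x \<in> inf_simplex" shows "pair_sum x k \<le> (\<Sum>i<k. x i)"
  by (rule pair_le_total[OF sum_nonneg_simplex[OF assms] sum_le_1[OF assms] pair_sum_le])

lemma cubic_map_in_simplex:
  assumes x: "x \<in> inf_simplex" shows "cubic_map x \<in> inf_simplex"
  unfolding inf_simplex_iff_sums
proof
  have x0: "\<And>i. 0 \<le> x i" and x1: "x sums 1"
    using x by (auto simp: inf_simplex_iff_sums)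
  show "\<forall>k. 0 \<le> cubic_map x k"
  proof
    fix k
    have "0 \<le> (x k)\<^sup>2 + 3 * (\<Sum>i<k. x i) - 3 * pair_sum x k"
      using pair_sum_le_sum[OF x, of k] zero_le_power2[of "x k"] by linarith
    with x0 show "0 \<le> cubic_map x k" unfolding cubic_map_def by (intro mult_nonneg_nonneg)
  qed
  let ?s = "\<lambda>n. \<Sum>i<n. x i"
  have s1: "?s \<longlonglongrightarrow> 1" using x1 by (simp add: sums_def)
  have "Bseq (pair_sum x)"
  proof (rule BseqI')
    fix n show "norm (pair_sum x n) \<le> 1"
      using pair_sum_nonneg[of x n] x0 pair_sum_le_sum[OF x, of n] sum_le_1[OF x, of n] by simp
  qed
  moreover have "Zfun (\<lambda>n. 1 - ?s n) sequentially"
    using tendsto_diff[OF tendsto_const s1, of 1] by (simp add: tendsto_Zfun_iff)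
  ultimately have z: "(\<lambda>n. pair_sum x n * (1 - ?s n)) \<longlonglongrightarrow> 0"
    using bounded_bilinear.Bfun_prod_Zfun[OF bounded_bilinear_mult, of "pair_sum x" sequentially]
    by (simp add: tendsto_Zfun_iff)
  have "(\<lambda>n. ?s n ^ 3 + 3 * (pair_sum x n * (1 - ?s n))) \<longlonglongrightarrow> 1 ^ 3 + 3 * 0"
    by (intro tendsto_intros s1 z)
  then show "cubic_map x sums 1"
    by (simp add: sums_def sum_cubic_map mult.assoc)
qed

section \<open>Injectivity\<close>

lemma cubic_strict_mono:
  fixes a b s e :: real
  assumes "0 \<le> a" "a < b" "e \<le> s"
  shows "a * (a\<^sup>2 + 3 * s - 3 * e) < b * (b\<^sup>2 + 3 * s - 3 * e)"
proof -
  have "a ^ 3 < b ^ 3" using assms by (intro power_strict_mono) auto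
  moreover have "a * (s - e) \<le> b * (s - e)" using assms by (intro mult_right_mono) auto
  ultimately show ?thesis by (simp add: algebra_simps power2_eq_square power3_eq_cube)
qed

text \<open>
  Two points with the same image agree coordinate by coordinate: if they agree below \<open>k\<close>, their
  \<open>k\<close>-th coordinates solve the same equation, whose left-hand side is strictly increasing.
\<close>

lemma inj_on_cubic_map: "inj_on cubic_map inf_simplex"
proof (rule inj_onI)
  fix x y assume x: "x \<in> inf_simplex" and y: "y \<in> inf_simplex" and eq: "cubic_map x = cubic_map y"
  have "x k = y k" for k
  proof (induction k rule: less_induct)
    case (less k)
    have s: "(\<Sum>i<k. x i) = (\<Sum>i<k. y i)" using less by (intro sum.cong) auto
    have e: "pair_sum x k = pair_sum y k"
      unfolding pair_sum_def using less by (intro sum.cong) auto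
    have x0: "0 \<le> x k" "0 \<le> y k" using x y by (auto simp: inf_simplex_iff_sums)
    show ?case
    proof (rule linorder_cases[of "x k" "y k"])
      assume "x k < y k"
      from cubic_strict_mono[OF x0(1) this pair_sum_le_sum[OF y, of k]] fun_cong[OF eq, of k]
      show ?thesis by (simp add: cubic_map_def s e)
    next
      assume "y k < x k"
      from cubic_strict_mono[OF x0(2) this pair_sum_le_sum[OF y, of k]] fun_cong[OF eq, of k]
      show ?thesis by (simp add: cubic_map_def s e)
    qed
  qed
  then show "x = y" by blast
qed

section \<open>Surjectivity\<close>

text \<open>
  The third assumption says that the image mass used up so far, together with \<open>y\<close>, does not
  exceed 1. As \<open>a = 1 - s\<close> brings the image mass to exactly 1, the cubic takes a value of at least
  \<open>y\<close> there, while it vanishes at 0.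
\<close>

lemma next_coordinate_exists:
  fixes s e y :: real
  assumes s: "s \<le> 1" and y: "0 \<le> y" and sy: "s ^ 3 + 3 * e * (1 - s) + y \<le> 1"
  obtains a where "0 \<le> a" "s + a \<le> 1" "a * (a\<^sup>2 + 3 * s - 3 * e) = y"
proof -
  let ?g = "\<lambda>a. a * (a\<^sup>2 + 3 * s - 3 * e)"
  have "s ^ 3 + 3 * e * (1 - s) + ?g (1 - s) = 1"
    by (simp add: algebra_simps power2_eq_square power3_eq_cube)
  then have "y \<le> ?g (1 - s)" using sy by linarith
  moreover have "continuous_on {0..1 - s} ?g" by (intro continuous_intros)
  ultimately obtain a where "0 \<le> a" "a \<le> 1 - s" "?g a = y"
    using IVT'[of ?g 0 y "1 - s"] s y by auto
  then show ?thesis by (intro that[of a]) auto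
qed

text \<open>
  The polynomial \<open>2 - 3 s\<^sup>2 + s\<^sup>3\<close> factors as \<open>(1 - s) (2 + 2 s - s\<^sup>2)\<close>.
\<close>

lemma no_lost_mass:
  fixes s :: real
  assumes "0 \<le> s" "s \<le> 1" "2 \<le> 3 * s\<^sup>2 - s ^ 3"
  shows "s = 1"
proof (rule ccontr)
  assume "s \<noteq> 1"
  moreover have "s\<^sup>2 \<le> 1" using assms by (simp add: power_le_one)
  ultimately have "0 < (1 - s) * (2 + 2 * s - s\<^sup>2)"
    using assms by (intro mult_pos_pos) auto
  also have "(1 - s) * (2 + 2 * s - s\<^sup>2) = 2 - (3 * s\<^sup>2 - s ^ 3)"
    by (simp add: algebra_simps power2_eq_square power3_eq_cube)
  finally show False using assms(3) by simp
qed

text \<open>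
  Coordinatewise solving keeps the partial sums of \<open>x\<close> at most 1, but gives no control from below, so
  at this stage part of the mass of \<open>x\<close> might be missing.
\<close>

lemma cubic_map_partial_preimage:
  assumes y: "y \<in> inf_simplex"
  obtains x where "\<And>k. 0 \<le> x k" "\<And>n. (\<Sum>i<n. x i) \<le> 1" "cubic_map x = y"
proof -
  \<comment> \<open>The pair records the partial sum and the pair sum of the coordinates chosen so far: they are
    all that the choice of the next coordinate depends on.\<close>
  define P where "P n = (\<lambda>(s, e). 0 \<le> s \<and> s \<le> 1 \<and> s ^ 3 + 3 * e * (1 - s) = (\<Sum>i<n. y i))" for n
  define Q where "Q n = (\<lambda>(s, e) (s', e'). s \<le> s' \<and> e' = e + (s' - s) * s
      \<and> (s' - s) * ((s' - s)\<^sup>2 + 3 * s - 3 * e) = y n)" for n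
  have "\<exists>st. \<forall>n. (P n (st n) \<and> (n = 0 \<longrightarrow> st n = (0, 0))) \<and> Q n (st n) (st (Suc n))"
  proof (rule dependent_nat_choice)
    show "\<exists>z. P 0 z \<and> (0 = (0::nat) \<longrightarrow> z = (0, 0))" by (auto simp: P_def)
  next
    fix z n assume "P n z \<and> (n = 0 \<longrightarrow> z = (0, 0))"
    then obtain s e where z: "z = (s, e)" and s: "0 \<le> s" "s \<le> 1"
      and m: "s ^ 3 + 3 * e * (1 - s) = (\<Sum>i<n. y i)" by (cases z) (auto simp: P_def)
    have "(\<Sum>i<n. y i) + y n \<le> 1" using sum_le_1[OF y, of "Suc n"] by simp
    moreover have "0 \<le> y n" using y by (simp add: inf_simplex_iff_sums)
    ultimately obtain a where a: "0 \<le> a" "s + a \<le> 1" "a * (a\<^sup>2 + 3 * s - 3 * e) = y n"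
      using next_coordinate_exists[of s "y n" e] s m by auto
    have "(s + a) ^ 3 + 3 * (e + a * s) * (1 - (s + a)) = (\<Sum>i<Suc n. y i)"
      unfolding sum.lessThan_Suc m[symmetric] a(3)[symmetric]
      by (simp add: algebra_simps power2_eq_square power3_eq_cube)
    then have "P (Suc n) (s + a, e + a * s)" "Q n z (s + a, e + a * s)"
      using a s by (auto simp: P_def Q_def z)
    then show "\<exists>z'. (P (Suc n) z' \<and> (Suc n = 0 \<longrightarrow> z' = (0, 0))) \<and> Q n z z'" by blast
  qed
  then obtain st where st: "\<And>n. P n (st n)" "st 0 = (0, 0)" "\<And>n. Q n (st n) (st (Suc n))" by blast
  define x where "x n = fst (st (Suc n)) - fst (st n)" for n
  have sum_x: "(\<Sum>i<n. x i) = fst (st n)" for n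
    by (induction n) (simp_all add: x_def st(2))
  have Q: "0 \<le> x n \<and> snd (st (Suc n)) = snd (st n) + x n * (\<Sum>i<n. x i)
      \<and> x n * ((x n)\<^sup>2 + 3 * (\<Sum>i<n. x i) - 3 * snd (st n)) = y n" for n
    using st(3)[of n] unfolding sum_x by (simp add: Q_def x_def split_beta)
  have pair_x: "pair_sum x n = snd (st n)" for n
    by (induction n) (use Q in \<open>auto simp: pair_sum_Suc st(2)\<close>)
  show ?thesis
  proof
    show "0 \<le> x k" for k using Q by blast
    show "(\<Sum>i<n. x i) \<le> 1" for n using st(1)[of n] by (auto simp: sum_x P_def)
    show "cubic_map x = y" using Q by (auto simp: cubic_map_def pair_x)
  qed
qed

lemma cubic_map_surj:
  assumes y: "y \<in> inf_simplex"
  shows "y \<in> cubic_map ` inf_simplex"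
proof -
  obtain x where x0: "\<And>k. 0 \<le> x k" and x1: "\<And>n. (\<Sum>i<n. x i) \<le> 1" and xy: "cubic_map x = y"
    using cubic_map_partial_preimage[OF y] by blast
  have "summable x" using x0 x1 by (intro summableI_nonneg_bounded)
  then have lim: "(\<lambda>n. \<Sum>i<n. x i) \<longlonglongrightarrow> suminf x" by (rule summable_LIMSEQ)
  have "2 * 1 \<le> 3 * (suminf x)\<^sup>2 - suminf x ^ 3"
  proof (rule LIMSEQ_le)
    show "(\<lambda>n. 2 * (\<Sum>i<n. y i)) \<longlonglongrightarrow> 2 * 1"
      using y by (intro tendsto_intros) (simp add: inf_simplex_iff_sums sums_def)
    show "(\<lambda>n. 3 * (\<Sum>i<n. x i)\<^sup>2 - (\<Sum>i<n. x i) ^ 3) \<longlonglongrightarrow> 3 * (suminf x)\<^sup>2 - suminf x ^ 3"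
      by (intro tendsto_intros lim)
    have "2 * (\<Sum>i<n. y i) \<le> 3 * (\<Sum>i<n. x i)\<^sup>2 - (\<Sum>i<n. x i) ^ 3" for n
    proof -
      let ?s = "\<Sum>i<n. x i"
      have "2 * pair_sum x n * (1 - ?s) \<le> ?s\<^sup>2 * (1 - ?s)"
        using x1[of n] by (intro mult_right_mono pair_sum_le) simp
      then show ?thesis
        unfolding xy[symmetric] sum_cubic_map
        by (simp add: algebra_simps power2_eq_square power3_eq_cube)
    qed
    then show "\<exists>N. \<forall>n\<ge>N. 2 * (\<Sum>i<n. y i) \<le> 3 * (\<Sum>i<n. x i)\<^sup>2 - (\<Sum>i<n. x i) ^ 3"
      by blast
  qed
  moreover have "0 \<le> suminf x" "suminf x \<le> 1"
    using \<open>summable x\<close> x0 x1 by (auto intro: suminf_nonneg suminf_le_const)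
  ultimately have "suminf x = 1" by (intro no_lost_mass) simp_all
  with \<open>summable x\<close> x0 have "x \<in> inf_simplex" by (simp add: inf_simplex_iff_sums sums_iff)
  with xy show ?thesis by blast
qed

section \<open>The heredity coefficients\<close>

text \<open>
  With \<open>k = i\<close>, the three terms of this coefficient are those of the bracket in \<open>cubic_map x k\<close>, as
  quadratic forms in \<open>x\<^sub>j\<close> and \<open>x\<^sub>l\<close>. In the middle term \<open>l\<close> is unrestricted: this stands for the
  factor \<open>\<Sum> x\<^sub>l = 1\<close> that makes \<open>\<Sum>i<k. x i\<close> quadratic.
\<close>

definition ordered_coeff :: "nat \<Rightarrow> nat \<Rightarrow> nat \<Rightarrow> real" where
  "ordered_coeff i j l = of_bool (j = i \<and> l = i) + 3 * of_bool (j < i) - 3 * of_bool (j < l \<and> l < i)"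

definition ordered_kernel :: "nat \<Rightarrow> nat \<Rightarrow> nat \<Rightarrow> nat \<Rightarrow> real" where
  "ordered_kernel k i j l = (if i = k then ordered_coeff i j l else 0)"

definition heredity :: "nat \<Rightarrow> nat \<Rightarrow> nat \<Rightarrow> nat \<Rightarrow> real" where
  "heredity i j l k = (ordered_kernel k i j l + ordered_kernel k i l j + ordered_kernel k j i l
     + ordered_kernel k j l i + ordered_kernel k l i j + ordered_kernel k l j i) / 6"

lemma heredity_symmetric:
  "heredity i j l k = heredity j i l k" "heredity i j l k = heredity i l j k"
  by (simp_all add: heredity_def add_ac)

lemma symmetric_triple_cases:
  fixes P :: "'a::linorder \<Rightarrow> 'a \<Rightarrow> 'a \<Rightarrow> bool"
  assumes "\<And>i j l. P i j l \<Longrightarrow> P j i l" "\<And>i j l. P i j l \<Longrightarrow> P i l j"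
    and "\<And>i j l. i \<le> j \<Longrightarrow> j \<le> l \<Longrightarrow> P i j l"
  shows "P i j l"
  using assms by (metis le_cases)

text \<open>
  Before the division by 6, for \<open>i < j < l\<close> the six rearrangements contribute \<open>3 + 3 - 3\<close> to the largest index, the
  subtracted term coming from the arrangement \<open>(l, i, j)\<close>, and 3 to the middle one. If two
  indices coincide, all 6 goes to the largest.
\<close>

lemma heredity_sorted:
  assumes "i \<le> j" "j \<le> l"
  shows "heredity i j l k =
    (if i < j \<and> j < l then (of_bool (k = j) + of_bool (k = l)) / 2 else of_bool (k = l))"
proof -
  consider "i = j" "j = l" | "i = j" "j < l" | "i < j" "j = l" | "i < j" "j < l" "i < l"
    using assms by linarith
  then show ?thesis
    by cases (auto simp: heredity_def ordered_kernel_def ordered_coeff_def)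
qed

lemma heredity_nonneg: "0 \<le> heredity i j l k"
  by (rule symmetric_triple_cases[of "\<lambda>i j l. 0 \<le> heredity i j l k"])
     (simp_all add: heredity_sorted flip: heredity_symmetric)

lemma heredity_sums: "(\<lambda>k. heredity i j l k) sums 1"
proof (rule symmetric_triple_cases[of "\<lambda>i j l. (\<lambda>k. heredity i j l k) sums 1"])
  fix i j l :: nat assume le: "i \<le> j" "j \<le> l"
  have single: "(\<lambda>k. of_bool (k = m) :: real) sums 1" for m :: nat
    using sums_single[of m "\<lambda>_. 1::real"] by (simp add: of_bool_def)
  show "(\<lambda>k. heredity i j l k) sums 1"
  proof (cases "i < j \<and> j < l")
    case True
    then show ?thesis
      using sums_divide[OF sums_add[OF single[of j] single[of l]], of 2]
      by (simp add: heredity_sorted[OF le])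
  next
    case False
    then have "heredity i j l k = of_bool (k = l)" for k
      by (auto simp: heredity_sorted[OF le])
    then show ?thesis
      using single[of l] by simp
  qed
qed (simp_all flip: heredity_symmetric)

lemma has_sum_mult_nonneg:
  fixes f :: "'a \<Rightarrow> real" and g :: "'b \<Rightarrow> real"
  assumes f: "(f has_sum a) A" and g: "(g has_sum b) B"
    and "\<And>i. i \<in> A \<Longrightarrow> 0 \<le> f i" "\<And>j. j \<in> B \<Longrightarrow> 0 \<le> g j"
  shows "((\<lambda>(i, j). f i * g j) has_sum a * b) (A \<times> B)"
proof (rule has_sum_SigmaI)
  show "((\<lambda>j. case (i, j) of (i, j) \<Rightarrow> f i * g j) has_sum f i * b) B" for i
    using has_sum_cmult_right[OF g] by simp
  show "((\<lambda>i. f i * b) has_sum a * b) A" by (rule has_sum_cmult_left[OF f])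
  show "(\<lambda>(i, j). f i * g j) summable_on A \<times> B"
    using has_sum_cmult_right[OF g] has_sum_imp_summable[OF has_sum_cmult_left[OF f, of b]] assms(3,4)
    by (intro summable_on_SigmaI[where g = "\<lambda>i. f i * b"]) auto
qed

lemma has_sum_simplex: "x \<in> inf_simplex \<Longrightarrow> (x has_sum 1) UNIV"
  by (auto simp: inf_simplex_iff_sums intro: sums_nonneg_imp_has_sum)

text \<open>
  Only the middle term has infinite support. It is a product of two nonnegative series, one of them
  finite and the other of sum 1.
\<close>

lemma ordered_coeff_has_sum:
  assumes x: "x \<in> inf_simplex"
  shows "((\<lambda>(j, l). ordered_coeff k j l * x j * x l) has_sum
           ((x k)\<^sup>2 + 3 * (\<Sum>i<k. x i) - 3 * pair_sum x k)) UNIV"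
proof -
  have x0: "\<And>i. 0 \<le> x i" using x by (simp add: inf_simplex_iff_sums)
  have 1: "((\<lambda>(j, l). of_bool (j = k \<and> l = k) * x j * x l) has_sum (x k)\<^sup>2) UNIV"
    by (rule has_sum_finite_neutralI[where B = "{(k, k)}"]) (auto simp: power2_eq_square)
  have "((\<lambda>j. of_bool (j < k) * x j) has_sum (\<Sum>i<k. x i)) UNIV"
    by (rule has_sum_finite_neutralI[where B = "{..<k}"]) auto
  from has_sum_mult_nonneg[OF this has_sum_simplex[OF x]] x0
  have 2: "((\<lambda>(j, l). of_bool (j < k) * x j * x l) has_sum (\<Sum>i<k. x i)) UNIV"
    by simp
  have 3: "((\<lambda>(j, l). of_bool (j < l \<and> l < k) * x j * x l) has_sum pair_sum x k) UNIV"
    by (rule has_sum_finite_neutralI[where B = "{(i, j). i < j \<and> j < k}"])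
       (auto simp: pair_sum_def finite_pairs_below intro!: sum.cong)
  from has_sum_add[OF has_sum_add[OF 1 has_sum_cmult_right[OF 2, of 3]] has_sum_cmult_right[OF 3, of "- 3"]]
  show ?thesis
    by (simp add: ordered_coeff_def algebra_simps case_prod_unfold)
qed

lemma ordered_kernel_has_sum:
  assumes x: "x \<in> inf_simplex"
  shows "((\<lambda>(i, j, l). ordered_kernel k i j l * x i * x j * x l) has_sum cubic_map x k) UNIV"
proof -
  let ?F = "\<lambda>(i, j, l). ordered_kernel k i j l * x i * x j * x l"
  have "((\<lambda>z. ?F (k, z)) has_sum cubic_map x k) UNIV"
    using has_sum_cmult_right[OF ordered_coeff_has_sum[OF x, of k], of "x k"]
    by (simp add: cubic_map_def ordered_kernel_def split_beta mult_ac)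
  then have "(?F has_sum cubic_map x k) (Pair k ` UNIV)"
    by (subst has_sum_reindex) (auto simp: o_def inj_on_def)
  then show ?thesis
    by (rule has_sum_cong_neutral[THEN iffD1, rotated -1]) (auto simp: ordered_kernel_def image_iff)
qed

lemma heredity_has_sum:
  assumes x: "x \<in> inf_simplex"
  shows "((\<lambda>(i, j, l). heredity i j l k * x i * x j * x l) has_sum cubic_map x k) UNIV"
proof -
  let ?F = "\<lambda>(i, j, l). ordered_kernel k i j l * x i * x j * x l"
  have perm: "((\<lambda>z. ?F (\<pi> z)) has_sum cubic_map x k) UNIV" if "bij \<pi>" for \<pi>
    using ordered_kernel_has_sum[OF x] has_sum_reindex_bij_betw[OF that, of ?F] by blast
  have b: "bij (\<lambda>(i, j, l). (i, l, j))" "bij (\<lambda>(i, j, l). (j, i, l))" "bij (\<lambda>(i, j, l). (j, l, i))"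
    "bij (\<lambda>(i, j, l). (l, i, j))" "bij (\<lambda>(i, j, l). (l, j, i))"
    by (rule o_bij[of "\<lambda>(i, j, l). (i, l, j)"] o_bij[of "\<lambda>(i, j, l). (j, i, l)"]
        o_bij[of "\<lambda>(i, j, l). (l, i, j)"] o_bij[of "\<lambda>(i, j, l). (j, l, i)"]
        o_bij[of "\<lambda>(i, j, l). (l, j, i)"]; force)+
  from has_sum_cmult_right[OF has_sum_add[OF has_sum_add[OF has_sum_add[OF has_sum_add[OF has_sum_add[OF
    perm[OF bij_id] perm[OF b(1)]] perm[OF b(2)]] perm[OF b(3)]] perm[OF b(4)]] perm[OF b(5)]], of "1/6"]
  have "((\<lambda>z. 1/6 * (?F (id z) + ?F (case z of (i, j, l) \<Rightarrow> (i, l, j)) + ?F (case z of (i, j, l) \<Rightarrow> (j, i, l))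
     + ?F (case z of (i, j, l) \<Rightarrow> (j, l, i)) + ?F (case z of (i, j, l) \<Rightarrow> (l, i, j))
     + ?F (case z of (i, j, l) \<Rightarrow> (l, j, i)))) has_sum cubic_map x k) UNIV"
    by simp
  then show ?thesis
    by (rule has_sum_cong[THEN iffD1, rotated]) (auto simp: heredity_def field_simps)
qed

lemma cubic_map_Volterra:
  assumes V: "\<And>x. x \<in> inf_simplex \<Longrightarrow> V x = cubic_map x"
  shows "cubic_Volterra_operator V"
proof -
  have "\<forall>i j l k. heredity i j l k = heredity i l j k \<and> heredity i j l k = heredity j i l k
      \<and> heredity i j l k = heredity j l i k \<and> heredity i j l k = heredity l i j k
      \<and> heredity i j l k = heredity l j i k"
    by (simp add: heredity_def add_ac)
  then have "cubic_stochastic_operator V"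
    unfolding cubic_stochastic_operator_def
    using heredity_nonneg heredity_sums heredity_has_sum cubic_map_in_simplex
    by (auto simp: V intro!: exI[of _ heredity])
  moreover have "V ` simplex_face \<alpha> \<subseteq> simplex_face \<alpha>" for \<alpha>
    using cubic_map_in_simplex by (auto simp: simplex_face_def V cubic_map_def)
  ultimately show ?thesis by (simp add: cubic_Volterra_operator_def)
qed

section \<open>Vertices and the theorem\<close>

lemma vertex_in_simplex: "(\<lambda>n. of_bool (n = m)) \<in> inf_simplex"
  using sums_single[of m "\<lambda>_. 1::real"] by (simp add: inf_simplex_iff_sums of_bool_def)

lemma suminf_vertex: "(\<Sum>n. of_bool (n = m) * g n) = (g m :: real)"
proof -
  have "(\<lambda>n. of_bool (n = m) * g n) = (\<lambda>n. if n = m then g n else 0)" by auto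
  then show ?thesis using sums_single[of m g, THEN sums_unique] by simp
qed

theorem mainTheorem2:
  fixes V :: "(nat \<Rightarrow> real) \<Rightarrow> nat \<Rightarrow> real"
    and f :: "nat \<Rightarrow> (nat \<Rightarrow> real) \<Rightarrow> real"
  assumes V: "\<And>x k. x \<in> inf_simplex \<Longrightarrow>
      V x k = x k * ((x k)\<^sup>2 + 3 * (\<Sum>i<k. x i)
                     - 3 * (\<Sum>(i, j)\<in>{(i, j). i < j \<and> j < k}. x i * x j))"
    and f: "\<And>x k. x \<in> inf_simplex \<Longrightarrow>
      f k x = (x k)\<^sup>2 + 3 * (\<Sum>i<k. x i)
              - 3 * (\<Sum>(i, j)\<in>{(i, j). i < j \<and> j < k}. x i * x j) - 1"
  shows "cubic_Volterra_operator V
       \<and> bij_betw V inf_simplex inf_simplex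
       \<and> (\<forall>x\<in>inf_simplex. \<forall>k. V x k = x k * (1 + f k x))
       \<and> \<not> (\<forall>x\<in>inf_simplex. \<forall>y\<in>inf_simplex.
              (\<Sum>k. x k * f k y) + (\<Sum>k. y k * f k x) \<le> 0)"
proof (intro conjI)
  have V': "V x = cubic_map x" if "x \<in> inf_simplex" for x
    using V[OF that] by (auto simp: cubic_map_def pair_sum_def)
  have f': "f k x = (x k)\<^sup>2 + 3 * (\<Sum>i<k. x i) - 3 * pair_sum x k - 1" if "x \<in> inf_simplex" for k x
    using f[OF that] by (simp add: pair_sum_def)
  show "cubic_Volterra_operator V" by (rule cubic_map_Volterra[OF V'])
  have "bij_betw cubic_map inf_simplex inf_simplex"
    unfolding bij_betw_def
    using inj_on_cubic_map cubic_map_surj cubic_map_in_simplex by blast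
  then show "bij_betw V inf_simplex inf_simplex"
    using bij_betw_cong[of inf_simplex V cubic_map] V' by blast
  show "\<forall>x\<in>inf_simplex. \<forall>k. V x k = x k * (1 + f k x)"
    by (simp add: V f)
  show "\<not> (\<forall>x\<in>inf_simplex. \<forall>y\<in>inf_simplex. (\<Sum>k. x k * f k y) + (\<Sum>k. y k * f k x) \<le> 0)"
  proof
    let ?u = "\<lambda>n::nat. of_bool (n = 0) :: real" and ?v = "\<lambda>n::nat. of_bool (n = 1) :: real"
    assume "\<forall>x\<in>inf_simplex. \<forall>y\<in>inf_simplex. (\<Sum>k. x k * f k y) + (\<Sum>k. y k * f k x) \<le> 0"
    then have "(\<Sum>k. ?u k * f k ?v) + (\<Sum>k. ?v k * f k ?u) \<le> 0"
      using vertex_in_simplex[of 0] vertex_in_simplex[of 1] by (elim ballE) auto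
    then have "f 0 ?v + f 1 ?u \<le> 0" by (simp only: suminf_vertex)
    moreover have "f 0 ?v = - 1" by (simp add: f'[OF vertex_in_simplex])
    moreover have "f 1 ?u = 2" 
      by (simp add: f'[OF vertex_in_simplex] pair_sum_Suc)
    ultimately show False by simp
  qed
qed
end
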